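(* Let $G$ be a graph and let $k$ be an integer with $2\le k\le |V(G)|$. Then $G$ has a spanning $k$-partite subgraph $H$ such that $\lambda(H)\ge \left\lceil \frac{k-1}{k}\lambda(G)\right\rceil$.
   Context: Graphs are finite, undirected, without loops or multiple edges. A subgraph $H$ of $G$ is spanning if $V(H)=V(G)$. A graph is $k$-partite if its vertex set can be partitioned into $k$ independent sets (some of which may be empty). For a graph $G$ on at least two vertices, the edge-connectivity $\lambda(G)$ is the minimum, over all pairs of distinct vertices $u,v$, of the maximum number of edge-disjoint $(u,v)$-paths in $G$; equivalently, the minimum over non-empty proper subsets $X\subset V(G)$ of the number of edges with exactly one end-vertex in $X$. *)

theory Defs
  imports
    Complex_Main
    "HOL-Library.Disjoint_Sets"
    "Graph_Theory.Graph_Theory"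
begin

text \<open>
  A finite simple undirected graph is rendered by the library locale \<^locale>\<open>graph\<close>: a finite,
  loop-free digraph without parallel arcs whose arc relation is symmetric. An undirected edge
  \<open>{u, v}\<close> is thus a pair of mutually opposite arcs, which \<open>edge_of\<close> identifies.
\<close>

definition edge_of :: "('a, 'b) pre_digraph \<Rightarrow> 'b \<Rightarrow> 'a set" where
  "edge_of G e = {tail G e, head G e}"

text \<open>
  Disjointness is required of the undirected edges: two paths traversing the same edge in opposite
  directions use different arcs but are not edge-disjoint.
\<close>

definition edge_disjoint_paths ::
  "('a, 'b) pre_digraph \<Rightarrow> 'a \<Rightarrow> 'a \<Rightarrow> 'b awalk set \<Rightarrow> bool" where
  "edge_disjoint_paths G u v P \<longleftrightarrow>
     (\<forall>p\<in>P. pre_digraph.apath G u p v) \<and>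
     (\<forall>p\<in>P. \<forall>q\<in>P. p \<noteq> q \<longrightarrow> edge_of G ` set p \<inter> edge_of G ` set q = {})"

definition local_edge_connectivity :: "('a, 'b) pre_digraph \<Rightarrow> 'a \<Rightarrow> 'a \<Rightarrow> nat" where
  "local_edge_connectivity G u v = Max {card P | P. edge_disjoint_paths G u v P}"

text \<open>Only meaningful for graphs with at least two vertices.\<close>

definition edge_connectivity :: "('a, 'b) pre_digraph \<Rightarrow> nat" where
  "edge_connectivity G =
     Min {local_edge_connectivity G u v | u v. u \<in> verts G \<and> v \<in> verts G \<and> u \<noteq> v}"

definition independent_set :: "('a, 'b) pre_digraph \<Rightarrow> 'a set \<Rightarrow> bool" where
  "independent_set G S \<longleftrightarrow> S \<subseteq> verts G \<and> (\<forall>u\<in>S. \<forall>v\<in>S. (u, v) \<notin> arcs_ends G)"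

definition k_partite :: "nat \<Rightarrow> ('a, 'b) pre_digraph \<Rightarrow> bool" where
  "k_partite k G \<longleftrightarrow>
     (\<exists>P :: nat \<Rightarrow> 'a set.
        (\<Union>i<k. P i) = verts G \<and>
        disjoint_family_on P {..<k} \<and>
        (\<forall>i<k. independent_set G (P i)))"

text \<open>The sets under \<open>Max\<close> and \<open>Min\<close> above are finite and non-empty.\<close>

lemma (in fin_digraph) local_edge_connectivity_set:
  "finite {card P | P. edge_disjoint_paths G u v P}"
  "{card P | P. edge_disjoint_paths G u v P} \<noteq> {}"
proof -
  have "finite {p. apath u p v}"
    by (rule apaths_finite)
  then have "finite (Pow {p. apath u p v})" by simp
  then have "finite (card ` Pow {p. apath u p v})" by simp
  then show "finite {card P | P. edge_disjoint_paths G u v P}"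
    by (rule rev_finite_subset) (auto simp: edge_disjoint_paths_def)
  have "edge_disjoint_paths G u v {}" by (simp add: edge_disjoint_paths_def)
  then show "{card P | P. edge_disjoint_paths G u v P} \<noteq> {}" by blast
qed

lemma (in fin_digraph) edge_connectivity_set:
  assumes "2 \<le> card (verts G)"
  shows "finite {local_edge_connectivity G u v | u v. u \<in> verts G \<and> v \<in> verts G \<and> u \<noteq> v}"
    and "{local_edge_connectivity G u v | u v. u \<in> verts G \<and> v \<in> verts G \<and> u \<noteq> v} \<noteq> {}"
proof -
  have "finite ((\<lambda>(u, v). local_edge_connectivity G u v) ` (verts G \<times> verts G))" by simp
  then show "finite {local_edge_connectivity G u v | u v. u \<in> verts G \<and> v \<in> verts G \<and> u \<noteq> v}"
    by (rule rev_finite_subset) auto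
  obtain u v where "u \<in> verts G" "v \<in> verts G" "u \<noteq> v"
    using assms card_le_Suc0_iff_eq[OF finite_verts] by force
  then show "{local_edge_connectivity G u v | u v. u \<in> verts G \<and> v \<in> verts G \<and> u \<noteq> v} \<noteq> {}"
    by blast
qed

end

theory Submission
  imports Defs "HOL-Number_Theory.Cong"
begin

text \<open>
  Colour the vertices with \<open>k\<close> colours so that the number of properly coloured edges is maximal,
  and let \<open>H\<close> consist of these edges. Cyclically shifting the colours on a vertex set \<open>S\<close> cannot
  improve the colouring, and averaging over all shifts shows that \<open>H\<close> keeps at least the fraction
  \<open>(k - 1) / k\<close> of the edges leaving \<open>S\<close>. Edge-connectivity is the size of a smallest edge cut by
  the edge version of Menger's theorem, which is proved with unit flows.
\<close>

section \<open>Edge cuts and the net outflow of arc sets\<close>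

definition cut_arcs :: "('a, 'b) pre_digraph \<Rightarrow> 'a set \<Rightarrow> 'b set" where
  "cut_arcs G S = {e \<in> arcs G. tail G e \<in> S \<and> head G e \<notin> S}"

text \<open>The net outflow at \<open>x\<close> of the unit flow carried by \<open>F\<close>.
  Writing it as one integer sum over arcs makes it additive in \<open>F\<close>.\<close>

definition excess :: "('a, 'b) pre_digraph \<Rightarrow> 'b set \<Rightarrow> 'a \<Rightarrow> int" where
  "excess G F x = (\<Sum>e\<in>F. of_bool (tail G e = x) - of_bool (head G e = x))"

text \<open>After exchanging the sums, an arc with both ends in \<open>S\<close> contributes 1 - 1,
  so only arcs crossing the boundary of \<open>S\<close> survive.\<close>

lemma sum_excess:
  assumes "finite S" "finite F"
  shows "(\<Sum>x\<in>S. excess G F x) =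
    int (card {e \<in> F. tail G e \<in> S \<and> head G e \<notin> S}) - int (card {e \<in> F. head G e \<in> S \<and> tail G e \<notin> S})"
proof -
  have "(\<Sum>x\<in>S. excess G F x) =
      (\<Sum>e\<in>F. \<Sum>x\<in>S. of_bool (tail G e = x) - of_bool (head G e = x))"
    unfolding excess_def by (rule sum.swap)
  also have "\<dots> = (\<Sum>e\<in>F. of_bool (tail G e \<in> S) - of_bool (head G e \<in> S))"
    using assms(1) by (intro sum.cong) (auto simp: sum_subtractf of_bool_def)
  also have "\<dots> = (\<Sum>e\<in>F. of_bool (tail G e \<in> S \<and> head G e \<notin> S) - of_bool (head G e \<in> S \<and> tail G e \<notin> S))"
    by (intro sum.cong) auto
  finally show ?thesis
    using assms(2) by (simp add: sum_subtractf Int_def)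
qed

text \<open>The contributions telescope along the walk; distinctness lets \<open>set p\<close> count
  every traversed arc once.\<close>

lemma excess_awalk:
  assumes "pre_digraph.cas G u p v" "distinct p"
  shows "excess G (set p) x = of_bool (u = x) - of_bool (v = x)"
proof -
  have "(\<Sum>e\<leftarrow>p. of_bool (tail G e = x) - of_bool (head G e = x)) = (of_bool (u = x) - of_bool (v = x) :: int)"
    using assms(1) by (induction p arbitrary: u) (auto simp: pre_digraph.cas.simps)
  then show ?thesis
    using assms(2) by (simp add: excess_def sum_list_distinct_conv_sum_set)
qed

section \<open>Decomposing flows into paths, and the easy half of Menger\<close>

context fin_digraph
begin

lemma apath_or_closed_set:
  assumes "F \<subseteq> arcs G" "u \<in> verts G"
  shows "(\<exists>p. apath u p v \<and> set p \<subseteq> F) \<or>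
    (\<exists>S\<subseteq>verts G. u \<in> S \<and> v \<notin> S \<and> (\<forall>e\<in>F. tail G e \<in> S \<longrightarrow> head G e \<in> S))"
proof -
  define K where "K = G\<lparr>arcs := F\<rparr>"
  have sub: "subgraph K G"
    using assms(1) wf_digraph by (intro subgraphI) (auto simp: K_def compatible_def wf_digraph_def)
  then interpret K: wf_digraph K by auto
  define S where "S = {x. u \<rightarrow>\<^sup>*\<^bsub>K\<^esub> x}"
  have "u \<in> S" "S \<subseteq> verts G"
    using assms(2) K.reachable_refl[of u] K.reachable_in_verts(2)[of u]
    by (auto simp: S_def) (simp_all add: K_def)
  moreover have "head G e \<in> S" if "e \<in> F" "tail G e \<in> S" for e
  proof -
    have "tail G e \<rightarrow>\<^bsub>K\<^esub> head G e"
      using that(1) by (auto simp: arcs_ends_conv K_def)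
    then show ?thesis
      using that(2) K.reachable_adj_trans by (auto simp: S_def)
  qed
  moreover have "\<exists>p. apath u p v \<and> set p \<subseteq> F" if v: "v \<in> S"
  proof -
    obtain p where p: "pre_digraph.apath K u p v"
      using v K.reachable_apath[of u v] by (auto simp: S_def)
    then have "set p \<subseteq> F"
      unfolding K.apath_def K.awalk_def by (simp add: K_def)
    then show ?thesis
      using p subgraph_apath_imp_apath[OF _ sub] by blast
  qed
  ultimately show ?thesis by blast
qed

text \<open>Paths are peeled off one by one. A set closed under \<open>F\<close> has non-positive
  net outflow, so a positive flow value forces a path inside \<open>F\<close>, and its removal
  lowers the value by one. Circulations may be left over, as the paths need not exhaust
  \<open>F\<close>.\<close>

lemma flow_path_decomposition:
  assumes "F \<subseteq> arcs G" "u \<in> verts G" "u \<noteq> v"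
    and "\<And>x. excess G F x = int n * (of_bool (u = x) - of_bool (v = x))"
  shows "\<exists>P. finite P \<and> card P = n \<and> (\<forall>p\<in>P. apath u p v \<and> set p \<subseteq> F) \<and>
    (\<forall>p\<in>P. \<forall>q\<in>P. p \<noteq> q \<longrightarrow> set p \<inter> set q = {})"
  using assms(1,4)
proof (induction n arbitrary: F)
  case 0
  then show ?case by (intro exI[of _ "{}"]) auto
next
  case (Suc n)
  have fin: "finite F"
    using Suc.prems(1) finite_arcs finite_subset by blast
  have "\<not> (\<exists>S\<subseteq>verts G. u \<in> S \<and> v \<notin> S \<and> (\<forall>e\<in>F. tail G e \<in> S \<longrightarrow> head G e \<in> S))"
  proof
    assume "\<exists>S\<subseteq>verts G. u \<in> S \<and> v \<notin> S \<and> (\<forall>e\<in>F. tail G e \<in> S \<longrightarrow> head G e \<in> S)"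
    then obtain S where S: "S \<subseteq> verts G" "u \<in> S" "v \<notin> S"
      and closed: "\<forall>e\<in>F. tail G e \<in> S \<longrightarrow> head G e \<in> S" by blast
    have finS: "finite S"
      using S(1) finite_verts finite_subset by blast
    have "card {e \<in> F. tail G e \<in> S \<and> head G e \<notin> S} = 0"
      using closed by (auto simp: card_eq_0_iff)
    then have "(\<Sum>x\<in>S. excess G F x) \<le> 0"
      unfolding sum_excess[OF finS fin] by linarith
    moreover have "(\<Sum>x\<in>S. excess G F x) = int (Suc n)"
      using S(2,3) finS by (simp add: Suc.prems(2) sum_subtractf flip: sum_distrib_left)
    ultimately show False by simp
  qed
  then obtain p where p: "apath u p v" "set p \<subseteq> F"
    using apath_or_closed_set[OF Suc.prems(1) assms(2)] by blast
  have p': "distinct p" "cas u p v"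
    using p(1) distinct_verts_imp_distinct by (auto simp: apath_def)
  have "excess G (F - set p) x = int n * (of_bool (u = x) - of_bool (v = x))" for x
  proof -
    have "excess G (F - set p) x = excess G F x - excess G (set p) x"
      unfolding excess_def using fin p(2) by (rule sum_diff)
    then show ?thesis
      by (simp add: Suc.prems(2) excess_awalk[OF p'(2,1)] algebra_simps)
  qed
  then obtain P where P: "finite P" "card P = n" "\<forall>q\<in>P. apath u q v \<and> set q \<subseteq> F - set p"
      "\<forall>p\<in>P. \<forall>q\<in>P. p \<noteq> q \<longrightarrow> set p \<inter> set q = {}"
    using Suc.IH[of "F - set p"] Suc.prems(1) by blast
  \<comment> \<open>Having an arc is what separates \<open>p\<close> from the members of
    \<open>P\<close>, which avoid all arcs of \<open>p\<close>; so the count really grows.\<close>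
  have "p \<noteq> []"
    using p'(2) assms(3) by auto
  then have "hd p \<in> set p"
    by simp
  then have "p \<notin> P"
    using P(3) by blast
  with P p show ?case
    by (intro exI[of _ "insert p P"]) auto
qed

text \<open>Every path from \<open>u\<close> to \<open>v\<close> leaves \<open>S\<close> through
  some arc of the cut, and edge-disjoint paths leave through different ones.\<close>

lemma local_edge_connectivity_le_cut:
  assumes "u \<in> S" "v \<notin> S"
  shows "local_edge_connectivity G u v \<le> card (cut_arcs G S)"
proof -
  have "\<exists>P. local_edge_connectivity G u v = card P \<and> edge_disjoint_paths G u v P"
    using Max_in[OF local_edge_connectivity_set] unfolding local_edge_connectivity_def by blast
  then obtain P where P: "local_edge_connectivity G u v = card P" "edge_disjoint_paths G u v P"
    by blast
  have leaves: "\<exists>e\<in>set p. tail G e \<in> S \<and> head G e \<notin> S" if "cas x p v" "x \<in> S" for x p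
    using that
  proof (induction p arbitrary: x)
    case Nil
    then show ?case using assms(2) by simp
  next
    case (Cons a p)
    then show ?case by (cases "head G a \<in> S") auto
  qed
  have "\<exists>e. e \<in> set p \<and> e \<in> cut_arcs G S" if "p \<in> P" for p
  proof -
    have "awalk u p v"
      using P(2) that by (auto simp: edge_disjoint_paths_def apath_def)
    then show ?thesis
      using leaves[of u p] assms(1) by (auto simp: awalk_def cut_arcs_def)
  qed
  then obtain f where f: "\<And>p. p \<in> P \<Longrightarrow> f p \<in> set p \<and> f p \<in> cut_arcs G S"
    by metis
  have "inj_on f P"
  proof (rule inj_onI, rule ccontr)
    fix p q assume pq: "p \<in> P" "q \<in> P" "f p = f q" "p \<noteq> q"
    then have "edge_of G (f p) \<in> edge_of G ` set p \<inter> edge_of G ` set q"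
      using f by (metis IntI imageI)
    moreover have "edge_of G ` set p \<inter> edge_of G ` set q = {}"
      using P(2) pq(1,2,4) unfolding edge_disjoint_paths_def by blast
    ultimately show False by blast
  qed
  then show ?thesis
    unfolding P(1) using f by (intro card_inj_on_le[of f]) (auto simp: cut_arcs_def)
qed

end

section \<open>Menger's theorem for edges\<close>

context graph
begin

text \<open>Symmetry supplies an opposite arc; the absence of parallel arcs makes the choice an
  involution.\<close>

lemma reverse_arc:
  obtains r where "\<And>e. e \<in> arcs G \<Longrightarrow> r e \<in> arcs G"
    "\<And>e. e \<in> arcs G \<Longrightarrow> tail G (r e) = head G e"
    "\<And>e. e \<in> arcs G \<Longrightarrow> head G (r e) = tail G e"
    "\<And>e. e \<in> arcs G \<Longrightarrow> r (r e) = e"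
proof -
  have "\<forall>e\<in>arcs G. \<exists>e'\<in>arcs G. tail G e' = head G e \<and> head G e' = tail G e"
    using sym_arcs unfolding symmetric_conv by metis
  then obtain r where r: "\<And>e. e \<in> arcs G \<Longrightarrow> r e \<in> arcs G \<and> tail G (r e) = head G e \<and> head G (r e) = tail G e"
    by metis
  have "r (r e) = e" if "e \<in> arcs G" for e
    using that r by (intro no_multi_arcs) (auto simp: arc_to_ends_def)
  with r show thesis
    by (intro that[of r]) blast+
qed

text \<open>Reversal matches outgoing with incoming arcs, so \<open>cut_arcs\<close> counts each
  undirected edge of the cut once.\<close>

lemma card_cut_reverse:
  "card {e \<in> arcs G. head G e \<in> S \<and> tail G e \<notin> S} = card (cut_arcs G S)"
proof -
  obtain r where r: "\<And>e. e \<in> arcs G \<Longrightarrow> r e \<in> arcs G"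
    "\<And>e. e \<in> arcs G \<Longrightarrow> tail G (r e) = head G e"
    "\<And>e. e \<in> arcs G \<Longrightarrow> head G (r e) = tail G e"
    "\<And>e. e \<in> arcs G \<Longrightarrow> r (r e) = e" by (rule reverse_arc) blast
  show ?thesis
    unfolding cut_arcs_def by (rule bij_betw_same_card[of r], rule bij_betw_byWitness[of _ r]) (auto simp: r)
qed

text \<open>
  Injectivity of \<open>edge_of\<close> says that the flow uses no edge in both directions. The arcs outside
  the flow then form the residual graph: adding a path of unused arcs and cancelling opposite
  pairs augments the flow, and if there is no such path, the set reachable from \<open>u\<close> has all
  its outgoing arcs and none of its incoming arcs in the flow.
\<close>

lemma antisymmetric_flow_exists:
  assumes "u \<in> verts G" "u \<noteq> v"
    and "\<And>S. S \<subseteq> verts G \<Longrightarrow> u \<in> S \<Longrightarrow> v \<notin> S \<Longrightarrow> n \<le> card (cut_arcs G S)"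
  shows "\<exists>F\<subseteq>arcs G. inj_on (edge_of G) F \<and>
    (\<forall>x. excess G F x = int n * (of_bool (u = x) - of_bool (v = x)))"
  using assms(3)
proof (induction n)
  case 0
  then show ?case by (intro exI[of _ "{}"]) (auto simp: excess_def)
next
  case (Suc n)
  obtain r where r: "\<And>e. e \<in> arcs G \<Longrightarrow> r e \<in> arcs G"
    "\<And>e. e \<in> arcs G \<Longrightarrow> tail G (r e) = head G e"
    "\<And>e. e \<in> arcs G \<Longrightarrow> head G (r e) = tail G e"
    "\<And>e. e \<in> arcs G \<Longrightarrow> r (r e) = e" by (rule reverse_arc) blast
  have edge_r: "edge_of G (r e) = edge_of G e" if "e \<in> arcs G" for e
    using r that by (auto simp: edge_of_def)
  obtain F where F: "F \<subseteq> arcs G" "inj_on (edge_of G) F"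
    and ex: "\<And>x. excess G F x = int n * (of_bool (u = x) - of_bool (v = x))"
    using Suc by (metis Suc_leD)
  have fin: "finite F"
    using F(1) finite_arcs finite_subset by blast
  \<comment> \<open>Since \<open>e\<close> and \<open>r e\<close> carry the same edge, injectivity
    of \<open>edge_of\<close> on \<open>F\<close> would make \<open>e\<close> a loop.\<close>
  have anti: "r e \<notin> F" if "e \<in> F" for e
  proof
    assume "r e \<in> F"
    then have "r e = e"
      using F that edge_r by (auto dest: inj_onD)
    then show False
      using r(2)[of e] no_loops[of e] F(1) that by auto
  qed
  have "\<not> (\<exists>S\<subseteq>verts G. u \<in> S \<and> v \<notin> S \<and> (\<forall>e\<in>arcs G - F. tail G e \<in> S \<longrightarrow> head G e \<in> S))"
  proof
    assume "\<exists>S\<subseteq>verts G. u \<in> S \<and> v \<notin> S \<and> (\<forall>e\<in>arcs G - F. tail G e \<in> S \<longrightarrow> head G e \<in> S)"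
    then obtain S where S: "S \<subseteq> verts G" "u \<in> S" "v \<notin> S"
      and closed: "\<forall>e\<in>arcs G - F. tail G e \<in> S \<longrightarrow> head G e \<in> S" by blast
    have finS: "finite S"
      using S(1) finite_verts finite_subset by blast
    have "{e \<in> F. tail G e \<in> S \<and> head G e \<notin> S} = cut_arcs G S"
      using closed F(1) by (auto simp: cut_arcs_def)
    moreover have "card {e \<in> F. head G e \<in> S \<and> tail G e \<notin> S} = 0"
    proof -
      have "False" if e: "e \<in> F" "head G e \<in> S" "tail G e \<notin> S" for e
      proof -
        have "r e \<in> arcs G - F" "tail G (r e) \<in> S" "head G (r e) \<notin> S"
          using e F(1) r anti by auto
        then show False using closed by blast
      qed
      then have "{e \<in> F. head G e \<in> S \<and> tail G e \<notin> S} = {}" by blast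
      then show ?thesis by (simp only: card.empty)
    qed
    ultimately have "(\<Sum>x\<in>S. excess G F x) = int (card (cut_arcs G S))"
      unfolding sum_excess[OF finS fin] by simp
    moreover have "(\<Sum>x\<in>S. excess G F x) = int n"
      using S(2,3) finS by (simp add: ex sum_subtractf flip: sum_distrib_left)
    ultimately show False
      using Suc.prems[OF S] by simp
  qed
  then obtain p where p: "apath u p v" "set p \<subseteq> arcs G - F"
    using apath_or_closed_set[of "arcs G - F" u v] assms(1) by blast
  have p': "distinct p" "cas u p v"
    using p(1) distinct_verts_imp_distinct by (auto simp: apath_def)
  define F' where "F' = F \<union> set p"
  define Q where "Q = {e \<in> F'. r e \<in> F'}"
  have F': "F' \<subseteq> arcs G" "finite F'"
    using F(1) p(2) fin by (auto simp: F'_def)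
  have exF': "excess G F' x = excess G F x + excess G (set p) x" for x
    unfolding excess_def F'_def using fin p(2) by (intro sum.union_disjoint) auto
  \<comment> \<open>\<open>r\<close> permutes \<open>Q\<close> and swaps tails with heads, so
    cancelling \<open>Q\<close> changes no excess.\<close>
  have exQ: "excess G Q x = 0" for x
  proof -
    have "(\<Sum>e\<in>Q. of_bool (tail G e = x)) = (\<Sum>e\<in>Q. of_bool (head G e = x) :: int)"
      using F'(1) r by (intro sum.reindex_bij_witness[of _ r r]) (auto simp: Q_def)
    then show ?thesis by (simp add: excess_def sum_subtractf)
  qed
  have "excess G (F' - Q) x = int (Suc n) * (of_bool (u = x) - of_bool (v = x))" for x
  proof -
    have "excess G (F' - Q) x = excess G F' x - excess G Q x"
      unfolding excess_def using F'(2) by (rule sum_diff) (auto simp: Q_def)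
    then show ?thesis
      by (simp add: exF' exQ ex excess_awalk[OF p'(2,1)] algebra_simps)
  qed
  moreover have "inj_on (edge_of G) (F' - Q)"
  proof (rule inj_onI)
    fix e f assume e: "e \<in> F' - Q" and f: "f \<in> F' - Q" and eq: "edge_of G e = edge_of G f"
    have arcs: "e \<in> arcs G" "f \<in> arcs G"
      using e f F'(1) by auto
    \<comment> \<open>Two arcs on one edge are equal or opposite; an opposite pair inside
      \<open>F'\<close> would lie in \<open>Q\<close>.\<close>
    from eq have "arc_to_ends G e = arc_to_ends G f \<or> arc_to_ends G (r e) = arc_to_ends G f"
      using r arcs by (auto simp: edge_of_def arc_to_ends_def doubleton_eq_iff)
    then have "e = f \<or> r e = f"
      using no_multi_arcs arcs r(1) by blast
    then show "e = f"
      using e f by (auto simp: Q_def)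
  qed
  ultimately show ?case
    using F'(1) by (intro exI[of _ "F' - Q"]) auto
qed

text \<open>If all separating cuts were larger than the local connectivity, there would be a flow of
  value one more, hence that many arc-disjoint paths. As the flow uses no edge in both directions,
  these are edge-disjoint, contradicting the maximum.\<close>

lemma edge_menger:
  assumes "u \<in> verts G" "u \<noteq> v"
  shows "\<exists>S\<subseteq>verts G. u \<in> S \<and> v \<notin> S \<and> card (cut_arcs G S) \<le> local_edge_connectivity G u v"
proof (rule ccontr)
  define n where "n = Suc (local_edge_connectivity G u v)"
  assume "\<not> ?thesis"
  then have "n \<le> card (cut_arcs G S)" if "S \<subseteq> verts G" "u \<in> S" "v \<notin> S" for S
    using that unfolding n_def not_less_eq_eq[symmetric] by blast
  then obtain F where F: "F \<subseteq> arcs G" "inj_on (edge_of G) F"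
    and ex: "\<And>x. excess G F x = int n * (of_bool (u = x) - of_bool (v = x))"
    using antisymmetric_flow_exists[OF assms, of n] by blast
  obtain P where P: "finite P" "card P = n" "\<forall>p\<in>P. apath u p v \<and> set p \<subseteq> F"
    "\<forall>p\<in>P. \<forall>q\<in>P. p \<noteq> q \<longrightarrow> set p \<inter> set q = {}"
    using flow_path_decomposition[OF F(1) assms ex] by blast
  have "edge_of G ` set p \<inter> edge_of G ` set q = {}" if "p \<in> P" "q \<in> P" "p \<noteq> q" for p q
    using that P(3,4) inj_on_image_Int[OF F(2), of "set p" "set q"] by auto
  then have "edge_disjoint_paths G u v P"
    using P(3) by (auto simp: edge_disjoint_paths_def)
  then have "card P \<le> local_edge_connectivity G u v"
    unfolding local_edge_connectivity_def
    by (intro Max_ge local_edge_connectivity_set) blast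
  then show False
    using P(2) by (simp add: n_def)
qed

section \<open>Subgraphs of properly coloured edges and optimal colourings\<close>

definition coloured_subgraph :: "('a \<Rightarrow> nat) \<Rightarrow> ('a, 'b) pre_digraph" where
  "coloured_subgraph c = G\<lparr>arcs := {e \<in> arcs G. c (tail G e) \<noteq> c (head G e)}\<rparr>"

lemma coloured_subgraph_simps [simp]:
  "verts (coloured_subgraph c) = verts G"
  "arcs (coloured_subgraph c) = {e \<in> arcs G. c (tail G e) \<noteq> c (head G e)}"
  "tail (coloured_subgraph c) = tail G"
  "head (coloured_subgraph c) = head G"
  by (simp_all add: coloured_subgraph_def)

lemma graph_coloured_subgraph: "graph (coloured_subgraph c)"
proof unfold_locales
  obtain r where r: "\<And>e. e \<in> arcs G \<Longrightarrow> r e \<in> arcs G"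
    "\<And>e. e \<in> arcs G \<Longrightarrow> tail G (r e) = head G e"
    "\<And>e. e \<in> arcs G \<Longrightarrow> head G (r e) = tail G e"
    "\<And>e. e \<in> arcs G \<Longrightarrow> r (r e) = e" by (rule reverse_arc) blast
  have "\<exists>e2\<in>arcs (coloured_subgraph c). tail G e = head G e2 \<and> head G e = tail G e2"
    if "e \<in> arcs (coloured_subgraph c)" for e
    using that r[of e] by (intro bexI[of _ "r e"]) auto
  then show "symmetric (coloured_subgraph c)"
    unfolding symmetric_conv by simp
qed (auto simp: arc_to_ends_def intro: no_multi_arcs dest: no_loops)

lemma spanning_coloured_subgraph: "spanning (coloured_subgraph c) G"
proof -
  interpret H: graph "coloured_subgraph c" by (rule graph_coloured_subgraph)
  show ?thesis
    unfolding spanning_def subgraph_def using wf_digraph H.wf_digraph by (auto simp: compatible_def)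
qed

lemma k_partite_coloured_subgraph:
  assumes "range c \<subseteq> {..<k}"
  shows "k_partite k (coloured_subgraph c)"
  unfolding k_partite_def
proof (intro exI[of _ "\<lambda>i. {v \<in> verts G. c v = i}"] conjI allI impI)
  show "(\<Union>i<k. {v \<in> verts G. c v = i}) = verts (coloured_subgraph c)"
    using assms by auto
  show "disjoint_family_on (\<lambda>i. {v \<in> verts G. c v = i}) {..<k}"
    by (auto simp: disjoint_family_on_def)
  show "independent_set (coloured_subgraph c) {v \<in> verts G. c v = i}" for i
    by (auto simp: independent_set_def arcs_ends_conv)
qed

text \<open>
  Adding \<open>j\<close> to the colours inside \<open>S\<close> only affects the edges leaving \<open>S\<close>, and over all
  shifts \<open>j\<close> each of them is monochromatic exactly once; so an optimal colouring
  does at least as well on these edges as the average shift.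
\<close>

lemma optimal_colouring_cut:
  assumes c: "range c \<subseteq> {..<k}"
    and opt: "\<And>d. range d \<subseteq> {..<k} \<Longrightarrow>
      card (arcs (coloured_subgraph d)) \<le> card (arcs (coloured_subgraph c))"
  shows "(k - 1) * card (cut_arcs G S) \<le> k * card (cut_arcs (coloured_subgraph c) S)"
proof -
  interpret H: graph "coloured_subgraph c" by (rule graph_coloured_subgraph)
  have k: "0 < k" and ck: "c x < k" for x
    using c by (auto intro: gr0I)
  \<comment> \<open>Both orientations of each cut edge are kept because \<open>opt\<close> counts
    arcs; the resulting factor 2 cancels at the end.\<close>
  define B where "B = {e \<in> arcs G. (tail G e \<in> S) \<noteq> (head G e \<in> S)}"
  define proper :: "('a \<Rightarrow> nat) \<Rightarrow> 'b \<Rightarrow> nat"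
    where "proper d e = of_bool (d (tail G e) \<noteq> d (head G e))" for d e
  define shift where "shift j x = (if x \<in> S then (c x + j) mod k else c x)" for j x
  have fin: "finite B" "B \<subseteq> arcs G"
    by (auto simp: B_def)
  have card_arcs: "card (arcs (coloured_subgraph d)) = sum (proper d) (arcs G)" for d
    by (simp add: proper_def Int_def)
  have inj_shift: "(a + j) mod k = (b + j) mod k \<longleftrightarrow> a = b" if "a < k" "b < k" for a b j
    using that cong_add_rcancel_nat[of a j b k] by (simp add: cong_def)
  have le: "sum (proper (shift j)) B \<le> sum (proper c) B" for j
  proof -
    \<comment> \<open>Off \<open>B\<close> the two ends are shifted together or not at all, and a
      shift is injective modulo \<open>k\<close>.\<close>
    have "proper (shift j) e = proper c e" if "e \<in> arcs G - B" for e
      using that inj_shift[OF ck ck] by (auto simp: proper_def shift_def B_def)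
    then have "sum (proper (shift j)) (arcs G - B) = sum (proper c) (arcs G - B)"
      by (intro sum.cong) auto
    moreover have "range (shift j) \<subseteq> {..<k}"
      using k ck by (auto simp: shift_def)
    then have "sum (proper (shift j)) (arcs G) \<le> sum (proper c) (arcs G)"
      using opt[of "shift j"] unfolding card_arcs by simp
    ultimately show ?thesis
      using sum.subset_diff[OF fin(2) finite_arcs, of "proper c"]
        sum.subset_diff[OF fin(2) finite_arcs, of "proper (shift j)"] by simp
  qed
  \<comment> \<open>The unique shift is b - a modulo \<open>k\<close>, written with
    \<open>k - a\<close> to avoid truncated subtraction.\<close>
  have one: "\<exists>i. {j. j < k \<and> (a + j) mod k = b} = {i}" if "a < k" "b < k" for a b
  proof (intro exI equalityI subsetI)
    fix j assume "j \<in> {j. j < k \<and> (a + j) mod k = b}"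
    then have "b = (if a + j < k then a + j else a + j - k)" "j < k"
      using that by (auto simp: le_mod_geq)
    then have "j = (b + (k - a)) mod k"
      using that by (cases "a + j < k") auto
    then show "j \<in> {(b + (k - a)) mod k}" by simp
  next
    fix j assume "j \<in> {(b + (k - a)) mod k}"
    then show "j \<in> {j. j < k \<and> (a + j) mod k = b}"
      using that by (auto simp: mod_simps)
  qed
  have avg: "(\<Sum>j<k. proper (shift j) e) = k - 1" if e: "e \<in> B" for e
  proof -
    \<comment> \<open>\<open>a\<close> is the colour of the end inside \<open>S\<close> and
      \<open>b\<close> that of the end outside, whichever way the arc points.\<close>
    obtain a b where ab: "a < k" "b < k"
      and p: "\<And>j. proper (shift j) e = of_bool ((a + j) mod k \<noteq> b)"
    proof (cases "tail G e \<in> S")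
      case True
      with e show ?thesis
        by (intro that[of "c (tail G e)" "c (head G e)"]) (auto simp: ck B_def proper_def shift_def)
    next
      case False
      with e show ?thesis
        by (intro that[of "c (head G e)" "c (tail G e)"]) (auto simp: ck B_def proper_def shift_def)
    qed
    obtain i where i: "{j. j < k \<and> (a + j) mod k = b} = {i}"
      using one[OF ab] by blast
    have "(\<Sum>j<k. proper (shift j) e) = card ({..<k} - {i})"
      unfolding p i[symmetric] by (simp add: Int_def) (rule arg_cong[of _ _ card], auto)
    moreover have "i < k" using i by blast
    ultimately show ?thesis by simp
  qed
  have "(k - 1) * card B = (\<Sum>e\<in>B. \<Sum>j<k. proper (shift j) e)"
    using avg by simp
  also have "\<dots> = (\<Sum>j<k. sum (proper (shift j)) B)"
    by (rule sum.swap)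
  also have "\<dots> \<le> (\<Sum>j<k. sum (proper c) B)"
    by (intro sum_mono le)
  also have "\<dots> = k * card {e \<in> B. c (tail G e) \<noteq> c (head G e)}"
    using fin by (simp add: proper_def Int_def)
  finally have main: "(k - 1) * card B \<le> k * card {e \<in> B. c (tail G e) \<noteq> c (head G e)}" .
  have "card B = card (cut_arcs G S) + card {e \<in> arcs G. head G e \<in> S \<and> tail G e \<notin> S}"
    unfolding cut_arcs_def by (subst card_Un_disjoint[symmetric]) (auto simp: B_def intro: arg_cong[of _ _ card])
  then have 1: "card B = 2 * card (cut_arcs G S)"
    using card_cut_reverse by simp
  have "card {e \<in> B. c (tail G e) \<noteq> c (head G e)} = card (cut_arcs (coloured_subgraph c) S) +
      card {e \<in> arcs (coloured_subgraph c). head G e \<in> S \<and> tail G e \<notin> S}"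
    unfolding cut_arcs_def by (subst card_Un_disjoint[symmetric]) (auto simp: B_def intro: arg_cong[of _ _ card])
  then have 2: "card {e \<in> B. c (tail G e) \<noteq> c (head G e)} = 2 * card (cut_arcs (coloured_subgraph c) S)"
    using H.card_cut_reverse[of S] by simp
  show ?thesis
    using main unfolding 1 2 by simp
qed

text \<open>Colourings are functions on the whole type and may be infinite in number, so the maximum
  comes from the bound \<open>card (arcs G)\<close> on the values; \<open>Suc\<close> makes that
  bound strict.\<close>

lemma optimal_colouring_exists:
  assumes "0 < k"
  obtains c where "range c \<subseteq> {..<k}"
    "\<And>d. range d \<subseteq> {..<k} \<Longrightarrow> card (arcs (coloured_subgraph d)) \<le> card (arcs (coloured_subgraph c))"
proof -
  have "card (arcs (coloured_subgraph d)) < Suc (card (arcs G))" for d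
    by (auto simp: less_Suc_eq_le intro: card_mono)
  moreover have "range (\<lambda>_. 0) \<subseteq> {..<k}"
    using assms by auto
  ultimately obtain c where "range c \<subseteq> {..<k}" "\<forall>d. range d \<subseteq> {..<k} \<longrightarrow>
      card (arcs (coloured_subgraph d)) \<le> card (arcs (coloured_subgraph c))"
    using ex_has_greatest_nat[of "\<lambda>d. range d \<subseteq> {..<k}" "\<lambda>_. 0"
      "\<lambda>d. card (arcs (coloured_subgraph d))" "Suc (card (arcs G))"] by blast
  then show thesis
    using that by blast
qed

end

theorem theorem1p3:
  fixes G :: "('a, 'b) pre_digraph" and k :: nat
  assumes "graph G"
    and "2 \<le> k" and "k \<le> card (verts G)"
  shows "\<exists>H :: ('a, 'b) pre_digraph.
           graph H \<and> spanning H G \<and> k_partite k H \<and>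
           int (edge_connectivity H) \<ge> \<lceil>(real k - 1) / real k * real (edge_connectivity G)\<rceil>"
proof -
  interpret graph G by (rule assms(1))
  obtain c where c: "range c \<subseteq> {..<k}"
    and opt: "\<And>d. range d \<subseteq> {..<k} \<Longrightarrow>
      card (arcs (coloured_subgraph d)) \<le> card (arcs (coloured_subgraph c))"
    using optimal_colouring_exists[of k] assms(2) by auto
  define H where "H = coloured_subgraph c"
  interpret H: graph H unfolding H_def by (rule graph_coloured_subgraph)
  have two: "2 \<le> card (verts G)" using assms(2,3) by simp
  then have "2 \<le> card (verts H)" by (simp add: H_def)
  then have "edge_connectivity H \<in>
      {local_edge_connectivity H u v | u v. u \<in> verts H \<and> v \<in> verts H \<and> u \<noteq> v}"
    unfolding edge_connectivity_def by (intro Min_in H.edge_connectivity_set)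
  then obtain u v where uv: "edge_connectivity H = local_edge_connectivity H u v"
    "u \<in> verts G" "v \<in> verts G" "u \<noteq> v"
    by (auto simp: H_def)
  \<comment> \<open>Menger in \<open>H\<close> turns the minimising pair into a cut of at most
    \<open>edge_connectivity H\<close> edges. The same \<open>S\<close> separates \<open>u\<close>
    from \<open>v\<close> in \<open>G\<close>, where the easy inequality bounds
    \<open>edge_connectivity G\<close>.\<close>
  obtain S where S: "u \<in> S" "v \<notin> S" "card (cut_arcs H S) \<le> edge_connectivity H"
    using H.edge_menger[of u v] uv by (auto simp: H_def)
  have "edge_connectivity G \<le> local_edge_connectivity G u v"
    unfolding edge_connectivity_def using uv two by (intro Min_le edge_connectivity_set) auto
  also have "\<dots> \<le> card (cut_arcs G S)"
    using S(1,2) by (rule local_edge_connectivity_le_cut)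
  finally have "(k - 1) * edge_connectivity G \<le> (k - 1) * card (cut_arcs G S)"
    by (rule mult_le_mono2)
  also have "\<dots> \<le> k * card (cut_arcs H S)"
    unfolding H_def by (rule optimal_colouring_cut[OF c opt])
  also have "\<dots> \<le> k * edge_connectivity H"
    using S(3) by simp
  finally have "real (k - 1) * real (edge_connectivity G) \<le> real k * real (edge_connectivity H)"
    by (metis of_nat_le_iff of_nat_mult)
  then have "(real k - 1) / real k * real (edge_connectivity G) \<le> real (edge_connectivity H)"
    using assms(2) by (simp add: field_simps of_nat_diff)
  then have "\<lceil>(real k - 1) / real k * real (edge_connectivity G)\<rceil> \<le> int (edge_connectivity H)"
    by (simp add: ceiling_le_iff)
  then show ?thesis
    using H.graph_axioms spanning_coloured_subgraph k_partite_coloured_subgraph[OF c]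
    unfolding H_def by blast
qed

end
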